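(* The generating function $K_3(x)=\sum_{n\ge 0} k_n^{\#3}x^n$ of the sequence $\{k_n^{\#3}\}_{n\geq0}$ is $$K_3(x)= \frac{-1-\sqrt{1-8x}+\sqrt{1-8x}\,\sqrt{1-4x}+\sqrt{1-4x}+4x}{4}.$$
   Context: The m-implication of type 2 is the connective $\psi\leftharpoonup\phi\equiv\neg\psi\to\phi$, which has value 0 (false) exactly when $\psi$ and $\phi$ both have value 0, and value 1 (true) otherwise. A bracketed formula with $n$ distinct variables is obtained from $p_1\leftharpoonup p_2\leftharpoonup\cdots\leftharpoonup p_n$ (variables in this fixed order) by fully inserting brackets; for $n\ge2$ it has the form $\psi\leftharpoonup\phi$ with $\psi$ a bracketing of $p_1\leftharpoonup\cdots\leftharpoonup p_i$ and $\phi$ a bracketing of $p_{i+1}\leftharpoonup\cdots\leftharpoonup p_n$ for some $1\le i\le n-1$. A row is a pair consisting of a bracketed formula and a valuation of $p_1,\dots,p_n$ in $\{0,1\}$. For $n\ge 2$, $k_n^{\#3}$ is the number of rows (over all bracketed formulae in $n$ variables) for which $\psi$ has value 0 and $\phi$ has value 1 (so that $\psi\leftharpoonup\phi$ is true); $k_0^{\#3}=k_1^{\#3}=0$. Square roots denote formal power series with positive constant term. *)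

theory Defs
  imports Complex_Main "HOL-Library.FuncSet"
    "HOL-Computational_Algebra.Formal_Power_Series"
begin

unbundle fps_syntax

datatype form = Var nat | Mimp form form (infix \<open>\<leftharpoonup>\<close> 65)

primrec val :: "(nat \<Rightarrow> bool) \<Rightarrow> form \<Rightarrow> bool" where
  "val v (Var i) = v i"
| "val v (\<psi> \<leftharpoonup> \<phi>) = (\<not> val v \<psi> \<longrightarrow> val v \<phi>)"

text \<open>\<open>bracketing i j \<chi>\<close>: the formula \<open>\<chi>\<close> arises from the chain
  \<open>p\<^sub>i \<leftharpoonup> p\<^sub>i\<^sub>+\<^sub>1 \<leftharpoonup> \<dots> \<leftharpoonup> p\<^sub>j\<close> by fully inserting brackets.\<close>

inductive bracketing :: "nat \<Rightarrow> nat \<Rightarrow> form \<Rightarrow> bool" where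
  single: "bracketing i i (Var i)"
| split: "bracketing i m \<psi> \<Longrightarrow> bracketing (Suc m) j \<phi> \<Longrightarrow> bracketing i j (\<psi> \<leftharpoonup> \<phi>)"

text \<open>Valuations are extensional functions on the index set, so that each assignment to
  \<open>p\<^sub>1, \<dots>, p\<^sub>n\<close> is counted exactly once.\<close>

definition valuations :: "nat \<Rightarrow> (nat \<Rightarrow> bool) set" where
  "valuations n = {1..n} \<rightarrow>\<^sub>E UNIV"

definition rows :: "nat \<Rightarrow> (form \<times> (nat \<Rightarrow> bool)) set" where
  "rows n = {\<chi>. bracketing 1 n \<chi>} \<times> valuations n"

definition k3 :: "nat \<Rightarrow> nat" where
  "k3 n = (if n < 2 then 0
     else card {(\<chi>, v) \<in> rows n. \<exists>\<psi> \<phi>. \<chi> = \<psi> \<leftharpoonup> \<phi> \<and> \<not> val v \<psi> \<and> val v \<phi>})"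

definition K3 :: "real fps" where
  "K3 = Abs_fps (\<lambda>n. of_nat (k3 n))"

abbreviation fps_sqrt :: "real fps \<Rightarrow> real fps" where
  "fps_sqrt \<equiv> fps_radical root 2"

text \<open>For a series with positive constant term, the library radical is the unique square root
  whose constant term is positive.\<close>

lemma fps_sqrt_iff:
  assumes "f $ 0 > 0"
  shows "g = fps_sqrt f \<longleftrightarrow> g\<^sup>2 = f \<and> g $ 0 > 0"
proof -
  have r0: "root 2 (f $ 0) ^ Suc 1 = f $ 0" "root 2 (f $ 0) > 0"
    using assms by (simp_all add: numeral_2_eq_2[symmetric])
  have sq: "(fps_sqrt f)\<^sup>2 = f"
    using power_radical[of f root 1] r0 assms by (simp add: numeral_2_eq_2)
  show ?thesis
  proof
    assume "g = fps_sqrt f"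
    then show "g\<^sup>2 = f \<and> g $ 0 > 0" using sq r0 by simp
  next
    assume g: "g\<^sup>2 = f \<and> g $ 0 > 0"
    then have "g = fps_sqrt f \<or> g = - fps_sqrt f"
      using sq power2_eq_iff[of g "fps_sqrt f"] by metis
    moreover have "g \<noteq> - fps_sqrt f"
    proof
      assume "g = - fps_sqrt f"
      then have "g $ 0 = - root 2 (f $ 0)" by simp
      then show False using g r0 by linarith
    qed
    ultimately show "g = fps_sqrt f" by blast
  qed
qed

lemma finite_bracketings: "finite {\<chi>. bracketing i j \<chi>}"
proof (induction "j - i" arbitrary: i j rule: less_induct)
  case less
  have le: "a \<le> b" if "bracketing a b \<chi>" for a b \<chi>
    using that by induction auto
  have "{\<chi>. bracketing i j \<chi>} \<subseteq> {Var i} \<union>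
      (\<Union>m\<in>{i..<j}. case_prod Mimp ` ({\<chi>. bracketing i m \<chi>} \<times> {\<chi>. bracketing (Suc m) j \<chi>}))"
    by (force elim: bracketing.cases dest: le)
  moreover have "finite {\<chi>. bracketing i m \<chi>} \<and> finite {\<chi>. bracketing (Suc m) j \<chi>}"
    if "m \<in> {i..<j}" for m
    using that by (intro conjI less) auto
  ultimately show ?case
    by (auto intro: finite_subset)
qed

lemma finite_rows: "finite (rows n)"
  by (auto simp: rows_def valuations_def intro!: finite_cartesian_product finite_PiE finite_bracketings)

end

(* Let F and W be the generating functions of the false and of the true rows. A formula is false
   exactly when both parts are, so F = x + F^2 and W = x + W^2 + 2 F W; hence F + W solves
   T = 2 x + T^2. Thus 1 - 2 F and 1 - 2 (F + W) are the square roots of 1 - 4 x and 1 - 8 x,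
   and K_3 = F W. *)

theory Submission
  imports Defs
begin

lemma bracketing_le: "bracketing i j \<chi> \<Longrightarrow> i \<le> j"
  by (induction rule: bracketing.induct) auto

text \<open>A variable spans one index only, and in a compound formula the end of the left part
  fixes where the right part starts. Consequently the position of the root split can be read off
  from the left part.\<close>

lemma bracketing_end_unique: "bracketing i j \<chi> \<Longrightarrow> bracketing i j' \<chi> \<Longrightarrow> j = j'"
proof (induction arbitrary: j' rule: bracketing.induct)
  case (single i)
  then show ?case by (auto elim: bracketing.cases)
next
  case (split i m \<psi> j \<phi>)
  from split.prems obtain m' where "bracketing i m' \<psi>" "bracketing (Suc m') j' \<phi>"
    by (auto elim: bracketing.cases)
  with split.IH show ?case by blast
qed

text \<open>Only the variables with index in \<open>{i..j}\<close> occur in the formula. This allows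
  valuations to be cut and glued without changing truth values.\<close>

lemma val_cong: "bracketing i j \<chi> \<Longrightarrow> (\<And>x. x \<in> {i..j} \<Longrightarrow> u x = v x) \<Longrightarrow> val u \<chi> = val v \<chi>"
proof (induction rule: bracketing.induct)
  case (split i m \<psi> j \<phi>)
  have "i \<le> m" "m < j" using split.hyps bracketing_le by fastforce+
  then have "val u \<psi> = val v \<psi>" "val u \<phi> = val v \<phi>"
    by (auto intro!: split.IH split.prems)
  then show ?case by simp
qed simp

text \<open>Arbitrary intervals are needed because the right part of a split starts at
  \<open>Suc m\<close>, not at 1. Extensionality on the interval makes each assignment count
  once.\<close>

definition val_rows :: "bool \<Rightarrow> nat \<Rightarrow> nat \<Rightarrow> (form \<times> (nat \<Rightarrow> bool)) set" where
  "val_rows b i j = {(\<chi>, v). bracketing i j \<chi> \<and> v \<in> {i..j} \<rightarrow>\<^sub>E UNIV \<and> val v \<chi> = b}"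

definition split_rows :: "bool \<Rightarrow> bool \<Rightarrow> nat \<Rightarrow> nat \<Rightarrow> (form \<times> (nat \<Rightarrow> bool)) set" where
  "split_rows a b i j = {(\<chi>, v). bracketing i j \<chi> \<and> v \<in> {i..j} \<rightarrow>\<^sub>E UNIV \<and>
     (\<exists>\<psi> \<phi>. \<chi> = \<psi> \<leftharpoonup> \<phi> \<and> val v \<psi> = a \<and> val v \<phi> = b)}"

text \<open>The inverse of cutting a row at its root split after index \<open>m\<close>.\<close>

definition join_rows ::
    "nat \<Rightarrow> (form \<times> (nat \<Rightarrow> bool)) \<times> (form \<times> (nat \<Rightarrow> bool)) \<Rightarrow> form \<times> (nat \<Rightarrow> bool)" where
  "join_rows m = (\<lambda>((\<psi>, u), (\<phi>, w)). (\<psi> \<leftharpoonup> \<phi>, \<lambda>x. if x \<le> m then u x else w x))"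

lemma finite_rows_between: "finite ({\<chi>. bracketing i j \<chi>} \<times> ({i..j} \<rightarrow>\<^sub>E (UNIV :: bool set)))"
  by (intro finite_cartesian_product finite_bracketings finite_PiE) auto

lemma finite_val_rows: "finite (val_rows b i j)"
  by (rule finite_subset[OF _ finite_rows_between[of i j]]) (auto simp: val_rows_def)

lemma finite_split_rows: "finite (split_rows a b i j)"
  by (rule finite_subset[OF _ finite_rows_between[of i j]]) (auto simp: split_rows_def)

text \<open>The two formulas are recovered from the root. Each valuation agrees with the glued one
  on its own side of \<open>m\<close>, and on the other side extensionality makes it
  \<open>undefined\<close>.\<close>

lemma inj_on_join_rows: "inj_on (join_rows m) (val_rows a i m \<times> val_rows b (Suc m) j)"
proof (rule inj_onI)
  fix p q
  assume "p \<in> val_rows a i m \<times> val_rows b (Suc m) j" "q \<in> val_rows a i m \<times> val_rows b (Suc m) j"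
    and "join_rows m p = join_rows m q"
  moreover obtain \<psi> u \<phi> w \<psi>' u' \<phi>' w' where
    pq: "p = ((\<psi>, u), (\<phi>, w))" "q = ((\<psi>', u'), (\<phi>', w'))"
    by (metis surj_pair)
  ultimately have rows: "(\<psi>, u) \<in> val_rows a i m" "(\<phi>, w) \<in> val_rows b (Suc m) j"
      "(\<psi>', u') \<in> val_rows a i m" "(\<phi>', w') \<in> val_rows b (Suc m) j"
    and eq: "join_rows m ((\<psi>, u), (\<phi>, w)) = join_rows m ((\<psi>', u'), (\<phi>', w'))"
    by auto
  have merged: "(if x \<le> m then u x else w x) = (if x \<le> m then u' x else w' x)" for x
    using eq unfolding join_rows_def by (auto dest!: fun_cong[where x = x])
  have "u x = u' x" for x
    using rows merged[of x] by (cases "x \<le> m") (auto simp: val_rows_def PiE_def extensional_def)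
  moreover have "w x = w' x" for x
    using rows merged[of x] by (cases "x \<le> m") (auto simp: val_rows_def PiE_def extensional_def)
  ultimately show "p = q"
    using eq by (auto simp: pq join_rows_def)
qed

lemma split_rows_eq:
  "split_rows a b i j =
     (\<Union>m\<in>{i..<j}. join_rows m ` (val_rows a i m \<times> val_rows b (Suc m) j))" (is "?L = ?R")
proof (intro set_eqI iffI)
  fix r assume "r \<in> ?L"
  then obtain \<psi> \<phi> v where r: "r = (\<psi> \<leftharpoonup> \<phi>, v)" and br: "bracketing i j (\<psi> \<leftharpoonup> \<phi>)"
    and v: "v \<in> {i..j} \<rightarrow>\<^sub>E UNIV" "val v \<psi> = a" "val v \<phi> = b"
    by (auto simp: split_rows_def)
  from br obtain m where m: "bracketing i m \<psi>" "bracketing (Suc m) j \<phi>"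
    by (auto elim: bracketing.cases)
  have le: "i \<le> m" "m < j" using m bracketing_le by fastforce+
  let ?u = "restrict v {i..m}" and ?w = "restrict v {Suc m..j}"
  have "(\<psi>, ?u) \<in> val_rows a i m" "(\<phi>, ?w) \<in> val_rows b (Suc m) j"
    using m v val_cong[OF m(1), of ?u v] val_cong[OF m(2), of ?w v] by (auto simp: val_rows_def)
  \<comment> \<open>Outside \<open>{i..j}\<close> both sides are \<open>undefined\<close>, since
    \<open>v\<close> is extensional there.\<close>
  moreover have "r = join_rows m ((\<psi>, ?u), (\<phi>, ?w))"
    using v le by (auto simp: r join_rows_def PiE_def extensional_def fun_eq_iff restrict_def)
  ultimately show "r \<in> ?R" using le by fastforce
next
  fix r assume "r \<in> ?R"
  then obtain m \<psi> u \<phi> w where le: "i \<le> m" "m < j"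
    and rows: "(\<psi>, u) \<in> val_rows a i m" "(\<phi>, w) \<in> val_rows b (Suc m) j"
    and r: "r = join_rows m ((\<psi>, u), (\<phi>, w))" by auto
  let ?v = "\<lambda>x. if x \<le> m then u x else w x"
  have m: "bracketing i m \<psi>" "bracketing (Suc m) j \<phi>" using rows by (auto simp: val_rows_def)
  have "val ?v \<psi> = a" "val ?v \<phi> = b"
    using rows val_cong[OF m(1), of ?v u] val_cong[OF m(2), of ?v w] by (auto simp: val_rows_def)
  moreover have "?v \<in> {i..j} \<rightarrow>\<^sub>E UNIV"
    using rows le by (auto simp: val_rows_def PiE_def extensional_def)
  ultimately show "r \<in> ?L"
    using bracketing.split[OF m] by (auto simp: r join_rows_def split_rows_def)
qed

lemma card_split_rows:
  "card (split_rows a b i j) = (\<Sum>m=i..<j. card (val_rows a i m) * card (val_rows b (Suc m) j))"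
proof -
  have "card (split_rows a b i j) =
      (\<Sum>m=i..<j. card (join_rows m ` (val_rows a i m \<times> val_rows b (Suc m) j)))"
    unfolding split_rows_eq
    \<comment> \<open>Pieces for different \<open>m\<close> are disjoint: a common row would have a
      left part ending at both positions.\<close>
    by (rule card_UN_disjoint)
      (auto simp: finite_val_rows, auto simp: val_rows_def join_rows_def dest: bracketing_end_unique)
  then show ?thesis
    by (simp add: card_image[OF inj_on_join_rows] card_cartesian_product)
qed

lemma card_val_rows_single: "card (val_rows b i i) = 1"
proof -
  have "bracketing i i \<chi> \<longleftrightarrow> \<chi> = Var i" for \<chi>
  proof
    assume "bracketing i i \<chi>"
    then show "\<chi> = Var i"
    proof cases
      case (split m \<psi> \<phi>)
      then have "i \<le> m" "Suc m \<le> i" by (auto dest: bracketing_le)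
      then show ?thesis by simp
    qed simp
  qed (auto intro: bracketing.single)
  \<comment> \<open>Moving the prescribed value into the codomain leaves a function space with
    exactly one element.\<close>
  moreover have "v \<in> {i} \<rightarrow>\<^sub>E UNIV \<and> v i = b \<longleftrightarrow> v \<in> {i} \<rightarrow>\<^sub>E {b}" for v
    unfolding PiE_iff by blast
  ultimately have "val_rows b i i = {Var i} \<times> ({i} \<rightarrow>\<^sub>E {b})"
    by (intro set_eqI) (simp add: val_rows_def split_beta mem_Times_iff cong: conj_cong)
  then show ?thesis by (simp add: card_cartesian_product card_PiE)
qed

text \<open>With at least two variables there is a root connective, and its truth table is false
  only when both parts are false.\<close>

lemma val_rows_split:
  assumes "i < j"
  shows "val_rows False i j = split_rows False False i j"
    and "val_rows True i j =
      split_rows True True i j \<union> (split_rows True False i j \<union> split_rows False True i j)"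
  using assms by (auto simp: val_rows_def split_rows_def elim: bracketing.cases)

lemma card_val_rows_split:
  assumes "i < j"
  shows "card (val_rows False i j) = card (split_rows False False i j)"
    and "card (val_rows True i j) =
      card (split_rows True True i j) + card (split_rows True False i j) + card (split_rows False True i j)"
proof -
  have "split_rows True False i j \<inter> split_rows False True i j = {}"
    "split_rows True True i j \<inter> (split_rows True False i j \<union> split_rows False True i j) = {}"
    by (auto simp: split_rows_def)
  then show "card (val_rows True i j) =
      card (split_rows True True i j) + card (split_rows True False i j) + card (split_rows False True i j)"
    by (simp add: val_rows_split[OF assms] card_Un_disjoint finite_split_rows)
qed (simp add: val_rows_split[OF assms])

text \<open>The two extreme terms of the Cauchy product vanish, leaving one term for each way to
  split \<open>Suc n\<close> into two positive sizes.\<close>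

lemma fps_mult_nth_Suc_of_nth_0:
  fixes f g :: "'a::comm_ring_1 fps"
  assumes "f $ 0 = 0" "g $ 0 = 0"
  shows "(f * g) $ Suc n = (\<Sum>k<n. f $ Suc k * g $ (n - k))"
proof -
  have "(f * g) $ Suc n = (\<Sum>k\<le>Suc n. f $ k * g $ (Suc n - k))"
    by (simp add: fps_mult_nth atLeast0AtMost)
  also have "\<dots> = (\<Sum>k<n. f $ Suc k * g $ (n - k))"
    using assms by (subst sum.atMost_Suc_shift) (simp add: lessThan_Suc_atMost[symmetric])
  finally show ?thesis .
qed

text \<open>Coefficients are indexed by the number of variables, so \<open>{i..i + k}\<close>
  belongs to \<open>Suc k\<close>. Both parts of a split are shorter than the whole, so counts for
  \<open>k < n\<close> suffice and the lemma can serve inside a strong induction.\<close>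

lemma card_split_rows_fps:
  fixes C :: "bool \<Rightarrow> real fps"
  assumes "\<And>b. C b $ 0 = 0"
    and C: "\<And>b i k. k < n \<Longrightarrow> card (val_rows b i (i + k)) = C b $ Suc k"
  shows "card (split_rows a b i (i + n)) = (C a * C b) $ Suc n"
proof -
  have "real (card (split_rows a b i (i + n))) =
      (\<Sum>m=0+i..<n+i. real (card (val_rows a i m)) * card (val_rows b (Suc m) (i + n)))"
    by (simp add: card_split_rows add.commute)
  also have "\<dots> = (\<Sum>k=0..<n. real (card (val_rows a i (i + k))) * card (val_rows b (Suc (i + k)) (i + n)))"
    by (subst sum.shift_bounds_nat_ivl) (simp add: add.commute)
  also have "\<dots> = (\<Sum>k=0..<n. C a $ Suc k * C b $ (n - k))"
  proof (intro sum.cong refl)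
    fix k assume k: "k \<in> {0..<n}"
    \<comment> \<open>The right part has \<open>n - k\<close> variables, which is offset
      \<open>n - Suc k\<close> from its start \<open>Suc (i + k)\<close>.\<close>
    then have "real (card (val_rows b (Suc (i + k)) (Suc (i + k) + (n - Suc k)))) = C b $ Suc (n - Suc k)"
      by (intro C) auto
    with k C[of k a i]
    show "real (card (val_rows a i (i + k))) * card (val_rows b (Suc (i + k)) (i + n)) = C a $ Suc k * C b $ (n - k)"
      by (simp add: Suc_diff_Suc)
  qed
  finally show ?thesis using assms(1) by (simp add: fps_mult_nth_Suc_of_nth_0 atLeast0LessThan)
qed

text \<open>With zero constant terms the two equations determine all coefficients recursively, and
  the row counts obey the same recursion. Hence it is enough to verify the equations for explicit
  candidates.\<close>

lemma card_val_rows_fps: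
  fixes C :: "bool \<Rightarrow> real fps"
  assumes C0: "\<And>b. C b $ 0 = 0"
    and F: "C False = fps_X + C False * C False"
    and W: "C True = fps_X + C True * C True + C True * C False + C False * C True"
  shows "card (val_rows b i (i + n)) = C b $ Suc n"
proof (induction n arbitrary: b i rule: less_induct)
  case (less n)
  have split: "card (split_rows a b i (i + n)) = (C a * C b) $ Suc n" for a b
    by (rule card_split_rows_fps[OF C0 less])
  show ?case
  proof (cases "n = 0")
    case True
    \<comment> \<open>A product of series without constant term has no linear term, so only
      \<open>fps_X\<close> contributes.\<close>
    have "C False $ 1 = 1" by (subst F) (simp add: fps_mult_nth_1' C0)
    moreover have "C True $ 1 = 1" by (subst W) (simp add: fps_mult_nth_1' C0)
    ultimately have "C b $ 1 = 1" by (cases b) simp_all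
    with True show ?thesis by (simp add: card_val_rows_single)
  next
    case False
    then have lt: "i < i + n" and X: "fps_X $ Suc n = (0 :: real)" by (auto simp: fps_X_nth)
    have "C False $ Suc n = (C False * C False) $ Suc n"
      by (subst F) (simp only: fps_add_nth X add_0)
    moreover have "C True $ Suc n =
        (C True * C True) $ Suc n + (C True * C False) $ Suc n + (C False * C True) $ Suc n"
      by (subst W) (simp only: fps_add_nth X add_0)
    ultimately show ?thesis
      by (cases b) (simp_all only: card_val_rows_split[OF lt] split of_nat_add)
  qed
qed

lemma k3_eq: "n \<ge> 2 \<Longrightarrow> k3 n = card (split_rows False True 1 n)"
  by (auto simp: k3_def rows_def valuations_def split_rows_def intro!: arg_cong[of _ _ card])

theorem proposition6p13:
  shows "K3 = (- 1 - fps_sqrt (1 - 8 * fps_X) + fps_sqrt (1 - 8 * fps_X) * fps_sqrt (1 - 4 * fps_X)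
               + fps_sqrt (1 - 4 * fps_X) + 4 * fps_X) / 4"
proof -
  define s8 where "s8 = fps_sqrt (1 - 8 * fps_X)"
  define s4 where "s4 = fps_sqrt (1 - 4 * fps_X)"
  have s: "s8\<^sup>2 = 1 - 8 * fps_X" "s4\<^sup>2 = 1 - 4 * fps_X"
    by (simp_all add: s8_def s4_def fps_sqrt_iff[THEN iffD1, OF _ refl])
  \<comment> \<open>\<open>C False\<close> and \<open>C True\<close> are the candidates for F and W.
    Both square roots have constant term 1, so the candidates have constant term 0.\<close>
  define C where "C b = fps_const (1/2) * (if b then s4 - s8 else 1 - s4)" for b
  have half: "2 * (fps_const (1/2) * f) = f" for f :: "real fps"
    by (simp add: numeral_fps_const mult.assoc[symmetric])
  have s4: "s4 = 1 - 2 * C False" and s8: "s8 = s4 - 2 * C True"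
    by (simp_all add: C_def half)
  have cancel4: "4 * f = 4 * g \<Longrightarrow> f = g" for f g :: "real fps"
    by simp
  have C0: "C b $ 0 = 0" for b
    by (simp add: C_def s4_def s8_def)
  \<comment> \<open>Completing the square: 4 F - 4 F^2 = 1 - (1 - 2 F)^2. The factor 4 avoids
    fractions.\<close>
  have "4 * C False - 4 * (fps_X + C False * C False) = 1 - 4 * fps_X - s4\<^sup>2"
    by (simp add: s4 power2_eq_square algebra_simps)
  then have F: "C False = fps_X + C False * C False"
    using s(2) by - (rule cancel4, simp)
  \<comment> \<open>This is the completed square for F + W, where 1 - 2 (F + W) is
    \<open>s8\<close>, minus the one for F.\<close>
  have "4 * C True - 4 * (fps_X + C True * C True + C True * C False + C False * C True) =
      s4\<^sup>2 - (1 - 4 * fps_X) - (s8\<^sup>2 - (1 - 8 * fps_X))"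
    by (simp add: s4 s8 power2_eq_square algebra_simps)
  then have W: "C True = fps_X + C True * C True + C True * C False + C False * C True"
    using s by - (rule cancel4, simp)
  note count = card_val_rows_fps[of C, OF C0 F W]
  have "K3 $ n = (C False * C True) $ n" for n
  proof (cases "n < 2")
    case True
    then have "n = 0 \<or> n = 1" by auto
    \<comment> \<open>The product of two series without constant term starts at x^2, matching the
      convention for fewer than two variables.\<close>
    then show ?thesis by (auto simp: K3_def k3_def fps_mult_nth_1 C0)
  next
    case False
    then obtain k where n: "n = Suc k" "k > 0" by (cases n) auto
    with False have "K3 $ n = card (split_rows False True 1 (1 + k))"
      by (simp add: K3_def k3_eq)
    also have "\<dots> = (C False * C True) $ Suc k"
      by (rule card_split_rows_fps[OF C0 count])
    finally show ?thesis using n by simp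
  qed
  then have "K3 = C False * C True" by (rule fps_ext)
  \<comment> \<open>Here 4 F W = (1 - s4) (s4 - s8), which becomes the stated numerator once
    \<open>s4\<^sup>2\<close> is replaced by 1 - 4 x.\<close>
  moreover have "- 1 - s8 + s8 * s4 + s4 + 4 * fps_X - 4 * (C False * C True) = s4\<^sup>2 - (1 - 4 * fps_X)"
    by (simp add: s4 s8 power2_eq_square algebra_simps)
  then have "- 1 - s8 + s8 * s4 + s4 + 4 * fps_X = 4 * (C False * C True)"
    using s(2) by simp
  ultimately show ?thesis
    unfolding s8_def[symmetric] s4_def[symmetric] by simp
qed

end
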